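(* Fix a positive integer $r\geq 3$ and a real number $\varepsilon>0$. Then for all sufficiently large integers $k$ (depending on $r$ and $\varepsilon$), we have \[\operatorname{ind}_r(k,\ell)\leq \operatorname{ind}_{\leq r}(k,\ell)\leq 100\cdot \ell^{-1/(2r)}\] for all integers $\ell$ with $1\leq \ell\leq (1-\varepsilon)k/r$.
   Context: A hypergraph has a finite vertex set and a set of edges, each edge being a non-empty subset of the vertex set. For a hypergraph $G$ with at least $k$ vertices, let $I(G,k,\ell)$ be the probability that a uniformly random $k$-vertex subset of $V(G)$ contains (as subsets) exactly $\ell$ edges of $G$. For $r\geq 1$ and $n\geq k$, let $I_r(n,k,\ell)$ be the maximum of $I(G,k,\ell)$ over all $r$-uniform hypergraphs $G$ on $n$ vertices, and $I_{\leq r}(n,k,\ell)$ the maximum of $I(G,k,\ell)$ over all hypergraphs $G$ on $n$ vertices all of whose edges have size at most $r$. Both are non-increasing in $n$; define $\operatorname{ind}_r(k,\ell)=\lim_{n\to\infty}I_r(n,k,\ell)$ and $\operatorname{ind}_{\leq r}(k,\ell)=\lim_{n\to\infty}I_{\leq r}(n,k,\ell)$. *)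

theory Defs
  imports "HOL-Probability.Probability"
begin

definition hypergraph :: "'a set \<Rightarrow> 'a set set \<Rightarrow> bool" where
  "hypergraph V E \<longleftrightarrow> finite V \<and> (\<forall>e\<in>E. e \<subseteq> V \<and> e \<noteq> {})"

(* Meaningful for k \<le> card V only, since pmf_of_set needs a non-empty set. *)
definition edge_prob :: "'a set \<Rightarrow> 'a set set \<Rightarrow> nat \<Rightarrow> nat \<Rightarrow> real" where
  "edge_prob V E k l =
     measure_pmf.prob (pmf_of_set {S. S \<subseteq> V \<and> card S = k})
       {S. card {e \<in> E. e \<subseteq> S} = l}"

(* Every hypergraph on n vertices is isomorphic to one whose vertices are natural numbers,
   so the maxima may be taken over vertex sets of type nat set. *)
definition I_unif :: "nat \<Rightarrow> nat \<Rightarrow> nat \<Rightarrow> nat \<Rightarrow> real" where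
  "I_unif r n k l =
     Max {edge_prob V E k l | (V :: nat set) E.
            hypergraph V E \<and> card V = n \<and> (\<forall>e\<in>E. card e = r)}"

definition I_atmost :: "nat \<Rightarrow> nat \<Rightarrow> nat \<Rightarrow> nat \<Rightarrow> real" where
  "I_atmost r n k l =
     Max {edge_prob V E k l | (V :: nat set) E.
            hypergraph V E \<and> card V = n \<and> (\<forall>e\<in>E. card e \<le> r)}"

definition ind_unif :: "nat \<Rightarrow> nat \<Rightarrow> nat \<Rightarrow> real" where
  "ind_unif r k l = lim (\<lambda>n. I_unif r n k l)"

definition ind_atmost :: "nat \<Rightarrow> nat \<Rightarrow> nat \<Rightarrow> real" where
  "ind_atmost r k l = lim (\<lambda>n. I_atmost r n k l)"

text \<open>The maxima are attained and the limits exist; both are shown for an arbitrary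
  restriction \<open>P\<close> on the edges.\<close>

definition edge_probs :: "(nat set \<Rightarrow> bool) \<Rightarrow> nat \<Rightarrow> nat \<Rightarrow> nat \<Rightarrow> real set" where
  "edge_probs P n k l =
     {edge_prob V E k l | (V :: nat set) E. hypergraph V E \<and> card V = n \<and> (\<forall>e\<in>E. P e)}"

definition good_sets :: "'a set \<Rightarrow> 'a set set \<Rightarrow> nat \<Rightarrow> nat \<Rightarrow> 'a set set" where
  "good_sets V E k l = {S. S \<subseteq> V \<and> card S = k \<and> card {e \<in> E. e \<subseteq> S} = l}"

lemma edge_prob_eq:
  assumes "finite V" "k \<le> card V"
  shows "edge_prob V E k l = real (card (good_sets V E k l)) / real (card V choose k)"
proof -
  let ?A = "{S. S \<subseteq> V \<and> card S = k}"
  have card: "card ?A = card V choose k"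
    using n_subsets[OF assms(1)] by simp
  have ne: "?A \<noteq> {}"
    using obtain_subset_with_card_n[OF assms(2)] by blast
  have fin: "finite ?A"
    using assms(1) by simp
  have "?A \<inter> {S. card {e \<in> E. e \<subseteq> S} = l} = good_sets V E k l"
    by (auto simp: good_sets_def)
  then show ?thesis
    unfolding edge_prob_def measure_pmf_of_set[OF ne fin] card by simp
qed

lemma finite_good_sets: "finite V \<Longrightarrow> finite (good_sets V E k l)"
  by (rule finite_subset[of _ "Pow V"]) (auto simp: good_sets_def)

lemma card_good_sets_le: "finite V \<Longrightarrow> card (good_sets V E k l) \<le> card V choose k"
  using n_subsets[of V k] card_mono[of "{S. S \<subseteq> V \<and> card S = k}" "good_sets V E k l"]
  by (auto simp: good_sets_def)

lemma finite_edge_probs: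
  assumes "k \<le> n"
  shows "finite (edge_probs P n k l)"
proof (rule finite_subset)
  show "edge_probs P n k l \<subseteq> (\<lambda>m. real m / real (n choose k)) ` {..n choose k}"
  proof
    fix x assume "x \<in> edge_probs P n k l"
    then obtain V :: "nat set" and E where *: "x = edge_prob V E k l" "finite V" "card V = n"
      unfolding edge_probs_def hypergraph_def by blast
    have "x = real (card (good_sets V E k l)) / real (n choose k)"
      using edge_prob_eq[of V k E l] * assms by simp
    moreover have "card (good_sets V E k l) \<in> {..n choose k}"
      using card_good_sets_le[OF *(2), of E k l] *(3) by simp
    ultimately show "x \<in> (\<lambda>m. real m / real (n choose k)) ` {..n choose k}"
      by blast
  qed
qed simp

lemma edge_probs_nonempty: "edge_probs P n k l \<noteq> {}"
proof -
  have "edge_prob {..<n} {} k l \<in> edge_probs P n k l"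
    unfolding edge_probs_def mem_Collect_eq
    by (intro exI[of _ "{..<n}"] exI[of _ "{}"]) (simp add: hypergraph_def)
  then show ?thesis by blast
qed

lemma good_sets_delete:
  "good_sets (V - {v}) {e \<in> E. e \<subseteq> V - {v}} k l = {S \<in> good_sets V E k l. v \<notin> S}"
proof -
  have "{e \<in> {e \<in> E. e \<subseteq> V - {v}}. e \<subseteq> S} = {e \<in> E. e \<subseteq> S}" if "S \<subseteq> V - {v}" for S
    using that by auto
  then have "S \<in> good_sets (V - {v}) {e \<in> E. e \<subseteq> V - {v}} k l \<longleftrightarrow>
      S \<in> {S \<in> good_sets V E k l. v \<notin> S}" for S
    unfolding good_sets_def mem_Collect_eq by (cases "S \<subseteq> V - {v}") (simp_all, blast+)
  then show ?thesis by blast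
qed

lemma sum_good_sets_delete:
  assumes "finite V"
  shows "(\<Sum>v\<in>V. card (good_sets (V - {v}) {e \<in> E. e \<subseteq> V - {v}} k l))
           = (card V - k) * card (good_sets V E k l)"
proof -
  let ?G = "good_sets V E k l"
  have fG: "finite ?G" by (rule finite_good_sets[OF assms])
  have "(\<Sum>v\<in>V. card {S \<in> ?G. v \<notin> S}) = (\<Sum>v\<in>V. \<Sum>S\<in>?G. if v \<notin> S then 1 else 0)"
    using fG by (intro sum.cong refl) (simp add: sum.If_cases Int_def)
  also have "\<dots> = (\<Sum>S\<in>?G. \<Sum>v\<in>V. if v \<notin> S then 1 else 0)"
    by (rule sum.swap)
  also have "\<dots> = (\<Sum>S\<in>?G. card V - k)"
  proof (rule sum.cong[OF refl])
    fix S assume "S \<in> ?G"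
    then have S: "S \<subseteq> V" "card S = k" by (auto simp: good_sets_def)
    have "(\<Sum>v\<in>V. if v \<notin> S then 1 else 0) = card (V - S)"
      using assms by (simp add: sum.If_cases Int_def set_diff_eq)
    also have "\<dots> = card V - k"
      using S assms by (simp add: card_Diff_subset finite_subset)
    finally show "(\<Sum>v\<in>V. if v \<notin> S then 1 else 0) = card V - k" .
  qed
  finally show ?thesis
    by (simp add: good_sets_delete mult.commute)
qed

lemma Max_edge_probs_Suc:
  assumes "k \<le> n"
  shows "Max (edge_probs P (Suc n) k l) \<le> Max (edge_probs P n k l)"
proof (rule Max.boundedI)
  let ?M = "Max (edge_probs P n k l)"
  show "finite (edge_probs P (Suc n) k l)"
    using assms by (simp add: finite_edge_probs)
  show "edge_probs P (Suc n) k l \<noteq> {}" by (rule edge_probs_nonempty)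
  fix x assume "x \<in> edge_probs P (Suc n) k l"
  then obtain V :: "nat set" and E where x: "x = edge_prob V E k l"
    and V: "finite V" "card V = Suc n" and E: "\<forall>e\<in>E. e \<subseteq> V \<and> e \<noteq> {}" "\<forall>e\<in>E. P e"
    unfolding edge_probs_def hypergraph_def by auto
  let ?E = "\<lambda>v. {e \<in> E. e \<subseteq> V - {v}}"
  have pos: "0 < real (n choose k)" "0 < real (Suc n choose k)"
    using assms by simp_all
  have le: "real (card (good_sets (V - {v}) (?E v) k l)) \<le> ?M * real (n choose k)"
    if v: "v \<in> V" for v
  proof -
    have c: "card (V - {v}) = n" "finite (V - {v})" using v V by simp_all
    have "hypergraph (V - {v}) (?E v)"
      using E V(1) by (auto simp: hypergraph_def)
    then have "edge_prob (V - {v}) (?E v) k l \<in> edge_probs P n k l"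
      unfolding edge_probs_def using c E(2) by blast
    then have "edge_prob (V - {v}) (?E v) k l \<le> ?M"
      using finite_edge_probs[OF assms] by (rule Max_ge[rotated])
    moreover have "edge_prob (V - {v}) (?E v) k l
        = real (card (good_sets (V - {v}) (?E v) k l)) / real (n choose k)"
      using edge_prob_eq[of "V - {v}" k "?E v" l] c assms by simp
    ultimately show ?thesis
      using pos by (simp add: divide_le_eq)
  qed
  have "real ((Suc n - k) * card (good_sets V E k l))
      = (\<Sum>v\<in>V. real (card (good_sets (V - {v}) (?E v) k l)))"
    using sum_good_sets_delete[OF V(1), of E k l] V(2) by (simp only: of_nat_sum[symmetric])
  also have "\<dots> \<le> (\<Sum>v\<in>V. ?M * real (n choose k))"
    by (rule sum_mono) (rule le)
  also have "\<dots> = ?M * real (Suc n * (n choose k))"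
    using V(2) by (simp add: algebra_simps)
  also have "Suc n * (n choose k) = (Suc n - k) * (Suc n choose k)"
    using binomial_absorb_comp[of "Suc n" k] by simp
  finally have "real (Suc n - k) * real (card (good_sets V E k l))
      \<le> real (Suc n - k) * (?M * real (Suc n choose k))"
    by (simp only: of_nat_mult mult_ac)
  then have "real (card (good_sets V E k l)) \<le> ?M * real (Suc n choose k)"
    using assms by (subst (asm) mult_le_cancel_left_pos) auto
  then show "x \<le> ?M"
    using edge_prob_eq[of V k E l] V assms pos by (simp add: x divide_le_eq)
qed

lemma convergent_Max_edge_probs: "convergent (\<lambda>n. Max (edge_probs P n k l))"
proof -
  let ?X = "\<lambda>n. Max (edge_probs P (n + k) k l)"
  have dec: "decseq ?X"
    by (rule decseq_SucI) (simp add: Max_edge_probs_Suc)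
  have nn: "0 \<le> ?X n" for n
  proof -
    have "?X n \<in> edge_probs P (n + k) k l"
      by (rule Max_in) (simp_all add: finite_edge_probs edge_probs_nonempty)
    then show ?thesis by (auto simp: edge_probs_def edge_prob_def)
  qed
  obtain L where "?X \<longlonglongrightarrow> L"
    using decseq_convergent[OF dec, of 0] nn by blast
  then show ?thesis
    using LIMSEQ_offset[of "\<lambda>n. Max (edge_probs P n k l)" k L] by (auto simp: convergent_def)
qed

lemma convergent_I_unif: "convergent (\<lambda>n. I_unif r n k l)"
  using convergent_Max_edge_probs[of "\<lambda>e. card e = r"]
  by (simp add: I_unif_def edge_probs_def)

lemma convergent_I_atmost: "convergent (\<lambda>n. I_atmost r n k l)"
  using convergent_Max_edge_probs[of "\<lambda>e. card e \<le> r"]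
  by (simp add: I_atmost_def edge_probs_def)

end

theory Submission
  imports Defs
begin

text \<open>
  Group the vertex sets with exactly \<open>l\<close> edges by the set \<open>L\<close> of these edges, and let
  \<open>m = card (\<Union>L)\<close>, so that \<open>l\<^sup>1\<^sup>/\<^sup>r r / 3 \<le> m \<le> r l \<le> (1 - \<epsilon>) k\<close> unless \<open>l\<close> is so small that
  the bound is trivial. Let \<open>P(K)\<close> be the probability that a random \<open>K\<close>-set has edge set \<open>L\<close>.

  The probability that a random \<open>K\<close>-set has at least \<open>l\<close> edges increases with \<open>K\<close>, and the
  step from \<open>K - 1\<close> to \<open>K\<close> is at least the sum over \<open>L\<close> of \<open>(m / K) P(K)\<close>: deleting a random
  vertex from a \<open>K\<close>-set with edge set \<open>L\<close> destroys an edge with probability \<open>m / K\<close>. Hence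
  the sum of \<open>(m / K) P(K)\<close> over all \<open>K\<close> and \<open>L\<close> is at most \<open>1\<close>.

  On the other hand, \<open>P(K + 1) / P(K) = (1 - q(K)) / (1 - m / (K + 1))\<close>, where \<open>q(K)\<close> is the
  probability that a random further vertex creates a new edge. As edges have at most \<open>r\<close>
  vertices, a double count in the style of Moon and Moser shows that \<open>q\<close> grows at most like
  \<open>(K - m)\<^sup>r\<^sup>-\<^sup>1\<close>. So once the ratio \<open>P(K + 1) / P(K)\<close> is at least \<open>1\<close>, it stays close to \<open>1\<close> or
  above on a window of length about \<open>(k - m) / sqrt (8 r m)\<close>. If it is at least \<open>1\<close> at \<open>k\<close>, then \<open>P\<close>
  stays above \<open>P(k) / 2\<close> to the right of \<open>k\<close>; otherwise it is not much larger than \<open>1\<close> shortly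
  before \<open>k\<close>, and \<open>P\<close> stays above \<open>P(k) / 2\<close> to the left of \<open>k\<close>. Combining this with the bound
  on the sum, the sum of \<open>P(k)\<close> over \<open>L\<close> is \<open>O(k / (k - m) sqrt (r / m))\<close>.
\<close>

section \<open>Elementary inequalities\<close>

lemma linear_decay:
  fixes Q :: "nat \<Rightarrow> real"
  assumes "0 \<le> a" and nonneg: "\<And>i. 0 \<le> Q i"
    and step: "\<And>i. i < n \<Longrightarrow> (1 - a) * Q i \<le> Q (Suc i)"
  shows "(1 - real n * a) * Q 0 \<le> Q n"
proof (cases "a \<le> 1")
  case True
  have "(1 - a) ^ i * Q 0 \<le> Q i" if "i \<le> n" for i
    using that
  proof (induction i)
    case (Suc i)
    then have "(1 - a) * ((1 - a) ^ i * Q 0) \<le> (1 - a) * Q i"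
      using True by (intro mult_left_mono) auto
    with step[of i] Suc.prems show ?case by (simp add: mult_ac)
  qed simp
  moreover have "(1 - real n * a) * Q 0 \<le> (1 - a) ^ n * Q 0"
    using Bernoulli_inequality[of "- a" n] True nonneg[of 0] by (simp add: mult_right_mono)
  ultimately show ?thesis by (meson order_refl order_trans)
next
  case False
  show ?thesis
  proof (cases n)
    case (Suc j)
    then have "1 * 1 \<le> real n * a" using False by (intro mult_mono) auto
    then have "(1 - real n * a) * Q 0 \<le> 0"
      using nonneg[of 0] by (simp add: mult_nonpos_nonneg)
    then show ?thesis using nonneg[of n] by linarith
  qed simp
qed

lemma sum_mult_le_of_add_const:
  fixes f g :: "'a \<Rightarrow> real"
  assumes const: "\<And>x. x \<in> S \<Longrightarrow> f x + g x = c"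
  shows "real (card S) * (\<Sum>x\<in>S. f x * g x) \<le> (\<Sum>x\<in>S. f x) * (\<Sum>x\<in>S. g x)"
proof -
  have g: "g x = c - f x" if "x \<in> S" for x using const[OF that] by simp
  have prod: "(\<Sum>x\<in>S. f x * g x) = c * (\<Sum>x\<in>S. f x) - (\<Sum>x\<in>S. (f x)\<^sup>2)"
    by (simp add: g algebra_simps power2_eq_square sum_subtractf sum_distrib_left)
  have sum: "(\<Sum>x\<in>S. g x) = real (card S) * c - (\<Sum>x\<in>S. f x)"
    by (simp add: g sum_subtractf)
  have "(\<Sum>x\<in>S. f x)\<^sup>2 \<le> real (card S) * (\<Sum>x\<in>S. (f x)\<^sup>2)"
    using Cauchy_Schwarz_ineq_sum[of "\<lambda>_. 1" f S] by simp
  then show ?thesis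
    unfolding prod sum by (simp add: algebra_simps power2_eq_square)
qed

lemma quotient_quasi_decreasing:
  fixes q q' y y' \<beta> \<gamma> \<eta> :: real
  assumes "q \<le> y" "y < 1" "y' < 1" "\<eta> \<le> 1" "0 \<le> y" "0 \<le> \<beta>" "0 \<le> \<gamma>"
    and q': "q' \<le> (1 + \<beta>) * q" and y': "(1 - \<gamma>) * y \<le> y'"
    and slack: "(\<beta> + \<gamma>) * y \<le> \<eta> * (1 - y)"
  shows "(1 - \<eta>) * ((1 - q) / (1 - y)) \<le> (1 - q') / (1 - y')"
proof -
  have "0 \<le> (\<beta> + \<gamma>) * y" using assms by simp
  also note slack
  finally have "0 \<le> \<eta>" using assms by (simp add: zero_le_mult_iff)
  have "(1 - \<eta>) * (1 - q) * (1 - y') \<le> (1 - \<eta>) * (1 - q) * (1 - y + \<gamma> * y)"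
    using assms by (intro mult_left_mono mult_nonneg_nonneg) (auto simp: algebra_simps)
  also have "\<dots> \<le> (1 - q - \<beta> * q) * (1 - y)"
  proof -
    have "\<beta> * (q * (1 - y)) \<le> \<beta> * (y * (1 - q))"
      using assms by (intro mult_left_mono) (auto simp: algebra_simps)
    moreover have "(1 - \<eta>) * ((1 - q) * (\<gamma> * y)) \<le> 1 * ((1 - q) * (\<gamma> * y))"
      using assms \<open>0 \<le> \<eta>\<close> by (intro mult_right_mono) auto
    moreover have "(1 - q) * ((\<beta> + \<gamma>) * y) \<le> (1 - q) * (\<eta> * (1 - y))"
      using assms by (intro mult_left_mono) auto
    ultimately show ?thesis by (simp add: algebra_simps)
  qed
  also have "\<dots> \<le> (1 - q') * (1 - y)"
    using assms by (intro mult_right_mono) (auto simp: algebra_simps)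
  finally show ?thesis
    using assms by (simp add: field_simps)
qed

section \<open>The window estimate\<close>

text \<open>In the application \<open>P K\<close> is the density of a family of \<open>K\<close>-sets containing a fixed \<open>m\<close>-set,
  \<open>loss K\<close> the probability that adding a random vertex to a random member leaves the family, and
  \<open>cover K\<close> the probability that a random vertex of a \<open>(K + 1)\<close>-set lies in the fixed \<open>m\<close>-set.\<close>

locale extension_profile =
  fixes P d :: "nat \<Rightarrow> real" and m n r :: nat
  assumes P_nonneg: "0 \<le> P K"
    and d_nonneg: "0 \<le> d K"
    and P_step: "m \<le> K \<Longrightarrow> K < n \<Longrightarrow>
      P (Suc K) * (1 - real m / real (Suc K)) = P K * (1 - d K / (real n - real K))"
    and d_step: "m \<le> K \<Longrightarrow>
      d (Suc K) * (1 - (real r - 1) / (real (Suc K) - real m)) \<le> d K"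
    and r_pos: "1 \<le> r"
begin

definition loss :: "nat \<Rightarrow> real" where
  "loss K = d K / (real n - real K)"

definition cover :: "nat \<Rightarrow> real" where
  "cover K = real m / real (Suc K)"

definition growth :: "nat \<Rightarrow> real" where
  "growth K = (1 - loss K) / (1 - cover K)"

lemma cover_nonneg: "0 \<le> cover K" and cover_less_1: "m \<le> K \<Longrightarrow> cover K < 1"
  by (simp_all add: cover_def)

lemma P_Suc:
  assumes "m \<le> K" "K < n"
  shows "P (Suc K) = growth K * P K"
proof -
  have "P (Suc K) * (1 - cover K) = P K * (1 - loss K)"
    using P_step[OF assms] by (simp only: cover_def loss_def)
  then show ?thesis using cover_less_1[OF assms(1)] by (simp add: growth_def field_simps)
qed

lemma d_decay_downwards:
  assumes "m \<le> lo" "lo \<le> hi"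
  shows "(1 - real (hi - lo) * ((real r - 1) / (real (Suc lo) - real m))) * d hi \<le> d lo"
proof -
  let ?a = "(real r - 1) / (real (Suc lo) - real m)"
  have step: "(1 - ?a) * d (hi - i) \<le> d (hi - Suc i)" if "i < hi - lo" for i
  proof -
    define K where "K = hi - Suc i"
    have K: "lo \<le> K" "hi - i = Suc K" using that by (auto simp: K_def)
    have "(real r - 1) / (real (Suc K) - real m) \<le> ?a"
      using K(1) assms(1) r_pos by (intro divide_left_mono) auto
    then have "(1 - ?a) * d (Suc K) \<le> (1 - (real r - 1) / (real (Suc K) - real m)) * d (Suc K)"
      by (intro mult_right_mono d_nonneg) simp
    also have "\<dots> \<le> d K" using d_step[of K] K(1) assms(1) by (simp add: mult.commute)
    finally show ?thesis by (simp only: K(2) K_def[symmetric])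
  qed
  have "0 \<le> ?a" using assms(1) r_pos by simp
  from linear_decay[OF this, of "\<lambda>i. d (hi - i)" "hi - lo"] step assms(2)
  show ?thesis by (simp add: d_nonneg)
qed

end

locale profile_window = extension_profile +
  fixes k w :: nat
  assumes m_less_k: "m < k" and n_large: "3 * k \<le> n" and m_large: "8 * r \<le> m"
    and narrow: "8 * real r * real m * (real w)\<^sup>2 \<le> (real k - real m)\<^sup>2"
begin

abbreviation gap :: real where
  "gap \<equiv> real k - real m"

definition width :: real where
  "width = real r * real w / gap"

definition decay :: real where
  "decay = 4 * width * real m / gap"

lemma gap_pos: "0 < gap"
  using m_less_k by simp

lemma r_w_le_gap: "8 * (real r * real w) \<le> gap"
proof (rule power2_le_imp_le)
  have "(8 * (real r * real w))\<^sup>2 = 8 * real r * (8 * real r) * (real w)\<^sup>2"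
    by (simp add: power2_eq_square)
  also have "\<dots> \<le> 8 * real r * real m * (real w)\<^sup>2"
    using of_nat_mono[OF m_large, where ?'a = real]
    by (intro mult_right_mono mult_left_mono) simp_all
  also note narrow
  finally show "(8 * (real r * real w))\<^sup>2 \<le> gap\<^sup>2" .
qed (use gap_pos in simp)

lemma w_le_r_w: "real w \<le> real r * real w"
  using mult_right_mono[of 1 "real r" "real w"] r_pos by simp

lemma m_w_le_k: "m + 8 * w \<le> k"
  using r_w_le_gap w_le_r_w by linarith

lemma margin_below:
  assumes "k \<le> lo + w"
  shows "m \<le> lo" "7 / 8 * gap \<le> real (Suc lo) - real m"
proof -
  show "m \<le> lo" using assms m_w_le_k by linarith
  have "real k \<le> real lo + real w" using of_nat_mono[OF assms, where ?'a = real] by simp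
  then show "7 / 8 * gap \<le> real (Suc lo) - real m"
    using r_w_le_gap w_le_r_w by simp
qed

lemma width_bounds: "0 \<le> width" "width \<le> 1 / 8" and width_gap: "width * gap = real r * real w"
  using gap_pos r_w_le_gap by (simp_all add: width_def field_simps)

lemma w_le_width_mult: "gap \<le> x \<Longrightarrow> real w \<le> width * x"
  using mult_left_mono[of "gap" x width] width_bounds(1) width_gap w_le_r_w by linarith

lemma decay_nonneg: "0 \<le> decay"
  using gap_pos width_bounds(1) by (simp add: decay_def)

lemma w_decay_le: "real w * decay \<le> 1 / 2"
proof -
  have "real w * decay = 4 * real r * real m * (real w)\<^sup>2 / gap\<^sup>2"
    by (simp add: decay_def width_def power2_eq_square)
  then show ?thesis using gap_pos narrow by (simp add: pos_divide_le_eq)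
qed

lemma decay_le_1: "0 < w \<Longrightarrow> decay \<le> 1"
  using mult_right_mono[of 1 "real w" decay] w_decay_le decay_nonneg by simp

lemma loss_growth_le:
  assumes "k \<le> lo + w" "lo \<le> hi" "hi \<le> lo + w" "hi \<le> k + w"
  shows "loss hi \<le> (1 + 5/2 * width) * loss lo"
proof -
  note below = margin_below[OF assms(1)]
  have above: "gap \<le> real n - real hi" "hi < n" "0 < real n - real lo"
    using assms(2,4) m_w_le_k n_large m_less_k by linarith+
  have loss_nonneg: "0 \<le> loss lo" using d_nonneg above by (simp add: loss_def)
  have "real (hi - lo) * ((real r - 1) / (real (Suc lo) - real m))
      \<le> (real w * real r) / (7 / 8 * gap)"
    unfolding times_divide_eq_right
    using assms r_pos below gap_pos by (intro frac_le mult_mono) auto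
  also have "\<dots> = 8 / 7 * width" using gap_pos by (simp add: width_def)
  finally have "(1 - 8 / 7 * width) * d hi
      \<le> (1 - real (hi - lo) * ((real r - 1) / (real (Suc lo) - real m))) * d hi"
    by (intro mult_right_mono d_nonneg) simp
  also have "\<dots> \<le> d lo" by (rule d_decay_downwards[OF below(1) assms(2)])
  also have "\<dots> = loss lo * (real n - real lo)" using above by (simp add: loss_def)
  also have "\<dots> \<le> loss lo * ((1 + width) * (real n - real hi))"
  proof (rule mult_left_mono)
    show "real n - real lo \<le> (1 + width) * (real n - real hi)"
      using w_le_width_mult[OF above(1)] assms(2,3) by (simp add: algebra_simps)
  qed (rule loss_nonneg)
  also have "\<dots> \<le> loss lo * ((1 + 5/2 * width) * (1 - 8 / 7 * width) * (real n - real hi))"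
  proof (intro mult_left_mono mult_right_mono)
    have "width * width \<le> width * (1 / 8)" using width_bounds by (intro mult_left_mono)
    then show "1 + width \<le> (1 + 5/2 * width) * (1 - 8 / 7 * width)" by (simp add: algebra_simps)
  qed (use above loss_nonneg in auto)
  also have "\<dots> = (1 - 8 / 7 * width) * ((1 + 5/2 * width) * loss lo * (real n - real hi))"
    by (simp only: mult_ac)
  finally have "d hi \<le> (1 + 5/2 * width) * loss lo * (real n - real hi)"
    using width_bounds(2) by (subst (asm) mult_le_cancel_left_pos) auto
  then show ?thesis using above by (simp add: loss_def[of hi] pos_divide_le_eq)
qed

lemma cover_decay_ge:
  assumes "k \<le> hi" "hi \<le> lo + w" "m \<le> lo"
  shows "(1 - width) * cover lo \<le> cover hi"
proof -
  have "real w \<le> width * real (Suc hi)" using assms(1) by (intro w_le_width_mult) auto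
  then have "(1 - width) * real (Suc hi) \<le> real (Suc lo)"
    using assms(2) by (simp add: algebra_simps)
  then have "real m * ((1 - width) * real (Suc hi)) \<le> real m * real (Suc lo)"
    by (intro mult_left_mono) auto
  then show ?thesis by (simp add: cover_def field_simps del: of_nat_Suc)
qed

lemma cover_mult_le_decay:
  assumes "k \<le> lo + w"
  shows "(5/2 * width + width) * cover lo \<le> decay * (1 - cover lo)"
proof -
  define s where "s = gap"
  then have "0 < s" using gap_pos by simp
  have "(5/2 * width + width) * cover lo = 4 * width / s * (7 / 8 * s) * cover lo"
    using \<open>0 < s\<close> by simp
  also have "\<dots> \<le> 4 * width / s * (real (Suc lo) - real m) * cover lo"
    using margin_below(2)[OF assms] \<open>0 < s\<close> width_bounds(1) cover_nonneg
    by (intro mult_right_mono mult_left_mono) (auto simp: s_def)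
  also have "\<dots> = decay * (1 - cover lo)"
  proof -
    have "1 - cover lo = (real (Suc lo) - real m) / real (Suc lo)"
      by (simp add: cover_def diff_divide_distrib)
    then show ?thesis by (simp add: decay_def cover_def s_def mult_ac)
  qed
  finally show ?thesis .
qed

lemma growth_quasi_decreasing:
  assumes "1 \<le> growth lo" "k \<le> hi" "lo \<le> hi" "hi \<le> lo + w" "hi \<le> k + w" "decay \<le> 1"
  shows "(1 - decay) * growth lo \<le> growth hi"
proof -
  have range: "m \<le> lo" "m \<le> hi" "k \<le> lo + w" using assms m_w_le_k m_less_k by linarith+
  have "loss lo \<le> cover lo"
    using assms(1) cover_less_1[OF range(1)] by (simp add: growth_def field_simps)
  then show ?thesis
    unfolding growth_def
    using loss_growth_le[OF range(3) assms(3-5)] cover_decay_ge[OF assms(2,4) range(1)]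
      cover_mult_le_decay[OF range(3)] assms(6) width_bounds(1)
    by (intro quotient_quasi_decreasing[where \<beta> = "5/2 * width" and \<gamma> = width]
        cover_less_1 cover_nonneg range) auto
qed

lemma half_le_if_slow_decay:
  assumes "\<And>i. 0 \<le> Q i" "\<And>i. i < w \<Longrightarrow> (1 - decay) * Q i \<le> Q (Suc i)" "i \<le> w"
  shows "Q 0 / 2 \<le> Q i"
proof -
  have "real i * decay \<le> real w * decay"
    using assms(3) decay_nonneg by (intro mult_right_mono) auto
  then have "1 / 2 * Q 0 \<le> (1 - real i * decay) * Q 0"
    using w_decay_le assms(1) by (intro mult_right_mono) auto
  also have "\<dots> \<le> Q i" using decay_nonneg assms by (intro linear_decay) auto
  finally show ?thesis by simp
qed

lemma slow_decay_right:
  assumes "1 \<le> growth k" "i < w"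
  shows "(1 - decay) * P (k + i) \<le> P (k + Suc i)"
proof -
  have decay: "decay \<le> 1" using decay_le_1 assms(2) by simp
  have "(1 - decay) * 1 \<le> (1 - decay) * growth k"
    using decay assms(1) by (intro mult_left_mono) auto
  also have "\<dots> \<le> growth (k + i)" using decay assms by (intro growth_quasi_decreasing) auto
  finally have "(1 - decay) * P (k + i) \<le> growth (k + i) * P (k + i)"
    using P_nonneg by (intro mult_right_mono) auto
  also have "\<dots> = P (k + Suc i)"
    using P_Suc[of "k + i"] m_less_k n_large m_w_le_k assms(2) by simp
  finally show ?thesis .
qed

lemma slow_decay_left:
  assumes "growth k < 1" "i < w"
  shows "(1 - decay) * P (k - i) \<le> P (k - Suc i)"
proof -
  define K where "K = k - Suc i"
  have K_bounds: "Suc K = k - i" "m \<le> K" "K < n" "K \<le> k" "k \<le> K + w"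
    using assms(2) m_w_le_k m_less_k n_large by (auto simp: K_def)
  have decay: "decay \<le> 1" using decay_le_1 assms(2) by simp
  have "(1 - decay) * growth K \<le> 1"
  proof (cases "1 \<le> growth K")
    case True
    then have "(1 - decay) * growth K \<le> growth k"
      using K_bounds decay by (intro growth_quasi_decreasing) auto
    with assms(1) show ?thesis by simp
  next
    case False
    then have "(1 - decay) * growth K \<le> (1 - decay) * 1"
      using decay by (intro mult_left_mono) auto
    with decay_nonneg show ?thesis by simp
  qed
  then have "(1 - decay) * growth K * P K \<le> 1 * P K" by (intro mult_right_mono P_nonneg)
  then have "(1 - decay) * P (Suc K) \<le> P K" by (simp add: P_Suc[OF K_bounds(2,3)] mult.assoc)
  then show ?thesis by (simp only: K_bounds(1)) (simp only: K_def)
qed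

lemma half_level_window:
  obtains a where "1 \<le> a" "a + w \<le> 2 * k" "\<And>K. K \<in> {a..a + w} \<Longrightarrow> P k / 2 \<le> P K"
proof (cases "1 \<le> growth k")
  case True
  have "P k / 2 \<le> P K" if "K \<in> {k..k + w}" for K
    using half_le_if_slow_decay[of "\<lambda>i. P (k + i)" "K - k"] slow_decay_right[OF True] that
    by (simp add: P_nonneg le_diff_conv)
  then show ?thesis using that[of k] m_less_k m_w_le_k by auto
next
  case False
  then have "growth k < 1" by simp
  have "P k / 2 \<le> P K" if "K \<in> {k - w..k - w + w}" for K
  proof -
    have offset: "k - K \<le> w" "k - (k - K) = K" using that m_w_le_k by auto
    show ?thesis
      using half_le_if_slow_decay[of "\<lambda>i. P (k - i)", OF P_nonneg _ offset(1)]
        slow_decay_left[OF \<open>growth k < 1\<close>] by (simp add: offset(2))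
  qed
  moreover have "1 \<le> k - w" "k - w + w \<le> 2 * k" using m_less_k m_w_le_k by linarith+
  ultimately show ?thesis using that by blast
qed

lemma window_sum_ge:
  "P k * (real (Suc w) * real m / (4 * real k)) \<le> (\<Sum>K\<in>{1..n}. real m / real K * P K)"
proof -
  obtain a where a: "1 \<le> a" "a + w \<le> 2 * k" "\<And>K. K \<in> {a..a + w} \<Longrightarrow> P k / 2 \<le> P K"
    using half_level_window by blast
  have "P k * (real (Suc w) * real m / (4 * real k))
      = (\<Sum>K\<in>{a..a + w}. real m / (2 * real k) * (P k / 2))" by simp
  also have "\<dots> \<le> (\<Sum>K\<in>{a..a + w}. real m / real K * P K)"
    using a P_nonneg by (intro sum_mono mult_mono divide_left_mono) auto
  also have "\<dots> \<le> (\<Sum>K\<in>{1..n}. real m / real K * P K)"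
    using a(1,2) n_large by (intro sum_mono2) (auto simp: P_nonneg)
  finally show ?thesis .
qed

end

definition window_weight :: "real \<Rightarrow> real \<Rightarrow> real \<Rightarrow> real" where
  "window_weight r k m = (k - m) / (4 * k) * sqrt (m / (8 * r))"

lemma (in extension_profile) window_weight_mult_le_sum:
  assumes "8 * r \<le> m" "m < k" "3 * k \<le> n"
  shows "P k * window_weight r k m \<le> (\<Sum>K\<in>{1..n}. real m / real K * P K)"
proof -
  define t where "t = sqrt (8 * real r * real m)"
  define w where "w = nat \<lfloor>(real k - real m) / t\<rfloor>"
  have pos: "0 < real m" "0 < real r" using r_pos assms(1) by auto
  then have t: "0 < t" "t\<^sup>2 = 8 * real r * real m" by (simp_all add: t_def)
  have w: "real w \<le> (real k - real m) / t" "(real k - real m) / t \<le> real (Suc w)"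
    using assms(2) t(1) unfolding w_def by (simp_all add: of_nat_floor) linarith+
  have "(real w * t)\<^sup>2 \<le> (real k - real m)\<^sup>2"
    using w(1) t(1) by (intro power_mono) (auto simp: field_simps)
  then interpret profile_window P d m n r k w
    using assms by unfold_locales (simp_all add: power_mult_distrib t(2) mult_ac)
  have "sqrt (real m / (8 * real r)) * t = real m"
    using pos unfolding t_def by (simp add: real_sqrt_mult[symmetric])
  then have "sqrt (real m / (8 * real r)) = real m / t" using t(1) by (simp add: field_simps)
  then have "P k * window_weight r k m = P k * ((real k - real m) / t * real m / (4 * real k))"
    by (simp add: window_weight_def)
  also have "\<dots> \<le> P k * (real (Suc w) * real m / (4 * real k))"
    using w(2) by (intro mult_left_mono divide_right_mono mult_right_mono P_nonneg) auto
  also have "\<dots> \<le> (\<Sum>K\<in>{1..n}. real m / real K * P K)" by (rule window_sum_ge)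
  finally show ?thesis .
qed

section \<open>Sets avoiding a hypergraph of bounded rank\<close>

lemma sum_insert_eq_sum_remove:
  fixes h :: "'a set \<Rightarrow> 'a \<Rightarrow> 'b::comm_monoid_add"
  assumes "finite \<A>" "finite \<B>"
    and "\<And>A. A \<in> \<A> \<Longrightarrow> finite (up A)" "\<And>A. A \<in> \<B> \<Longrightarrow> finite (down A)"
    and up: "\<And>A v. A \<in> \<A> \<Longrightarrow> v \<in> up A \<Longrightarrow> v \<notin> A \<and> insert v A \<in> \<B> \<and> v \<in> down (insert v A)"
    and down: "\<And>A v. A \<in> \<B> \<Longrightarrow> v \<in> down A \<Longrightarrow> v \<in> A \<and> A - {v} \<in> \<A> \<and> v \<in> up (A - {v})"
  shows "(\<Sum>A\<in>\<A>. \<Sum>v\<in>up A. h A v) = (\<Sum>A\<in>\<B>. \<Sum>v\<in>down A. h (A - {v}) v)"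
proof -
  have "(\<Sum>A\<in>\<A>. \<Sum>v\<in>up A. h A v) = (\<Sum>(A, v)\<in>(SIGMA A:\<A>. up A). h A v)"
    using assms(1,3) by (intro sum.Sigma) auto
  also have "\<dots> = (\<Sum>(A, v)\<in>(SIGMA A:\<B>. down A). h (A - {v}) v)"
    by (rule sum.reindex_bij_witness[where i = "\<lambda>(A, v). (A - {v}, v)"
          and j = "\<lambda>(A, v). (insert v A, v)"]) (auto dest: up down)
  also have "\<dots> = (\<Sum>A\<in>\<B>. \<Sum>v\<in>down A. h (A - {v}) v)"
    using assms(2,4) by (intro sum.Sigma[symmetric]) auto
  finally show ?thesis .
qed

lemma Suc_times_binomial_Suc: "Suc K * (n choose Suc K) = (n - K) * (n choose K)"
  using binomial_absorb_comp[of n K] binomial_absorption[of K n] by simp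

locale forbidden_subsets =
  fixes V B :: "'a set" and H :: "'a set set" and r :: nat
  assumes finite_V: "finite V" and B_subset: "B \<subseteq> V"
    and rank: "\<And>e. e \<in> H \<Longrightarrow> finite e \<and> card e \<le> r" and rank_pos: "1 \<le> r"
begin

definition free :: "'a set \<Rightarrow> bool" where
  "free A \<longleftrightarrow> (\<forall>e\<in>H. \<not> e \<subseteq> A)"

definition free_sets :: "nat \<Rightarrow> 'a set set" where
  "free_sets K = {A. B \<subseteq> A \<and> A \<subseteq> V \<and> card A = K \<and> free A}"

definition extensions :: "'a set \<Rightarrow> 'a set" where
  "extensions A = {v \<in> V - A. free (insert v A)}"

definition blockers :: "'a set \<Rightarrow> 'a set" where
  "blockers A = {v \<in> V - A. \<not> free (insert v A)}"

definition blocked_pairs :: "nat \<Rightarrow> nat" where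
  "blocked_pairs K = (\<Sum>A\<in>free_sets K. card (blockers A))"

lemma free_mono: "free A \<Longrightarrow> A' \<subseteq> A \<Longrightarrow> free A'"
  unfolding free_def by blast

lemma finite_B: "finite B"
  using B_subset finite_V by (rule finite_subset)

lemma finite_free_sets: "finite (free_sets K)"
  by (rule finite_subset[of _ "Pow V"]) (auto simp: free_sets_def finite_V)

lemma finite_extensions: "finite (extensions A)" and finite_blockers: "finite (blockers A)"
  using finite_V by (simp_all add: extensions_def blockers_def)

lemma free_setsD:
  assumes "A \<in> free_sets K"
  shows "B \<subseteq> A" "A \<subseteq> V" "card A = K" "free A" "finite A"
  using assms finite_subset[OF _ finite_V] by (auto simp: free_sets_def)

lemma remove_in_free_sets:
  assumes "A \<in> free_sets (Suc K)" "v \<in> A - B"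
  shows "A - {v} \<in> free_sets K"
  using free_setsD[OF assms(1)] assms(2) free_mono[of A "A - {v}"] by (auto simp: free_sets_def)

lemma sum_extensions_eq_sum_removals:
  fixes h :: "'a set \<Rightarrow> 'a \<Rightarrow> 'b::comm_monoid_add"
  shows "(\<Sum>A\<in>free_sets K. \<Sum>v\<in>extensions A. h A v)
    = (\<Sum>A\<in>free_sets (Suc K). \<Sum>v\<in>A - B. h (A - {v}) v)"
proof (rule sum_insert_eq_sum_remove)
  fix A v assume A: "A \<in> free_sets K" and v: "v \<in> extensions A"
  then show "v \<notin> A \<and> insert v A \<in> free_sets (Suc K) \<and> v \<in> insert v A - B"
    using free_setsD[OF A] by (auto simp: extensions_def free_sets_def)
next
  fix A v assume A: "A \<in> free_sets (Suc K)" and v: "v \<in> A - B"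
  then show "v \<in> A \<and> A - {v} \<in> free_sets K \<and> v \<in> extensions (A - {v})"
    using free_setsD[OF A] remove_in_free_sets[OF A v] by (auto simp: extensions_def insert_absorb)
qed (auto simp: finite_free_sets finite_extensions dest: free_setsD)

lemma card_removable:
  assumes "A \<in> free_sets (Suc K)"
  shows "card (A - B) = Suc K - card B"
  using free_setsD[OF assms] by (simp add: card_Diff_subset finite_B)

lemma sum_card_extensions:
  "(\<Sum>A\<in>free_sets K. card (extensions A)) = (Suc K - card B) * card (free_sets (Suc K))"
  using sum_extensions_eq_sum_removals[of "\<lambda>_ _. 1 :: nat" K] by (simp add: card_removable)

lemma card_extensions_add_card_blockers:
  assumes "A \<in> free_sets K"
  shows "card (extensions A) + card (blockers A) = card V - K"
proof -
  have "card (extensions A) + card (blockers A) = card (extensions A \<union> blockers A)"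
    by (rule card_Un_disjoint[symmetric])
      (simp_all add: finite_extensions finite_blockers, auto simp: extensions_def blockers_def)
  also have "extensions A \<union> blockers A = V - A"
    by (auto simp: extensions_def blockers_def)
  also have "card (V - A) = card V - K"
    using free_setsD[OF assms] by (simp add: card_Diff_subset)
  finally show ?thesis .
qed

lemma blocked_pairs_add_removals:
  "blocked_pairs K + (Suc K - card B) * card (free_sets (Suc K))
    = (card V - K) * card (free_sets K)"
proof -
  have "blocked_pairs K + (Suc K - card B) * card (free_sets (Suc K))
      = (\<Sum>A\<in>free_sets K. card (extensions A) + card (blockers A))"
    by (simp add: blocked_pairs_def sum_card_extensions[symmetric] sum.distrib)
  also have "\<dots> = (card V - K) * card (free_sets K)"
    by (simp add: card_extensions_add_card_blockers)
  finally show ?thesis .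
qed

text \<open>A blocker completes a forbidden set having at most \<open>r - 1\<close> vertices in \<open>A\<close>, and it stays a
  blocker as long as none of these is removed.\<close>

lemma card_removals_keeping_blocker:
  assumes A: "A \<in> free_sets (Suc K)" and v: "v \<in> blockers A"
  shows "Suc K - card B - (r - 1) \<le> card {i \<in> A - B. v \<in> blockers (A - {i})}"
proof -
  obtain e where e: "e \<in> H" "e \<subseteq> insert v A" "v \<in> V" "v \<notin> A"
    using v by (auto simp: blockers_def free_def)
  then have "v \<in> e" using free_setsD(4)[OF A] by (auto simp: free_def)
  then have "card (e - {v}) \<le> r - 1" using rank[OF e(1)] by (auto intro: diff_le_mono)
  then have "Suc K - card B - (r - 1) \<le> card (A - B) - card (e - {v})"
    using card_removable[OF A] by simp
  also have "\<dots> \<le> card (A - B - (e - {v}))"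
    using rank[OF e(1)] by (intro diff_card_le_card_Diff) simp
  also have "\<dots> \<le> card {i \<in> A - B. v \<in> blockers (A - {i})}"
    using e free_setsD(5)[OF A] by (intro card_mono) (auto simp: blockers_def free_def)
  finally show ?thesis .
qed

lemma card_blockers_le_sum_removals:
  assumes A: "A \<in> free_sets (Suc K)"
  shows "(Suc K - card B - (r - 1)) * card (blockers A) \<le> (\<Sum>i\<in>A - B. card (blockers (A - {i})))"
proof -
  have "(Suc K - card B - (r - 1)) * card (blockers A)
      = (\<Sum>v\<in>blockers A. Suc K - card B - (r - 1))" by simp
  also have "\<dots> \<le> (\<Sum>v\<in>blockers A. card {i \<in> A - B. v \<in> blockers (A - {i})})"
    by (intro sum_mono card_removals_keeping_blocker[OF A])
  also have "\<dots> = (\<Sum>i\<in>A - B. card {v \<in> blockers A. v \<in> blockers (A - {i})})"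
    unfolding card_eq_sum
    using free_setsD(5)[OF A] finite_blockers by (intro sum.swap_restrict) auto
  also have "\<dots> \<le> (\<Sum>i\<in>A - B. card (blockers (A - {i})))"
    by (intro sum_mono card_mono finite_blockers) auto
  finally show ?thesis .
qed

lemma moon_moser:
  "(Suc K - card B - (r - 1)) * blocked_pairs (Suc K) * card (free_sets K)
    \<le> (Suc K - card B) * card (free_sets (Suc K)) * blocked_pairs K"
proof -
  have "(Suc K - card B - (r - 1)) * blocked_pairs (Suc K)
      \<le> (\<Sum>A\<in>free_sets (Suc K). \<Sum>i\<in>A - B. card (blockers (A - {i})))"
    unfolding blocked_pairs_def sum_distrib_left
    by (intro sum_mono card_blockers_le_sum_removals)
  also have "\<dots> = (\<Sum>A\<in>free_sets K. card (extensions A) * card (blockers A))"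
    using sum_extensions_eq_sum_removals[of "\<lambda>A _. card (blockers A)" K] by simp
  finally have "(Suc K - card B - (r - 1)) * blocked_pairs (Suc K) * card (free_sets K)
      \<le> card (free_sets K) * (\<Sum>A\<in>free_sets K. card (extensions A) * card (blockers A))"
    by simp
  also have "\<dots> \<le> (\<Sum>A\<in>free_sets K. card (extensions A)) * (\<Sum>A\<in>free_sets K. card (blockers A))"
    using sum_mult_le_of_add_const[of "free_sets K" "\<lambda>A. real (card (extensions A))"
        "\<lambda>A. real (card (blockers A))" "real (card V - K)"]
    by (simp only: of_nat_add[symmetric] of_nat_mult[symmetric] of_nat_sum[symmetric] of_nat_le_iff
        card_extensions_add_card_blockers)
  finally show ?thesis by (simp add: sum_card_extensions blocked_pairs_def)
qed

lemma card_free_sets_pos: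
  assumes "card B \<le> K" "0 < card (free_sets (Suc K))"
  shows "0 < card (free_sets K)"
proof -
  obtain A where A: "A \<in> free_sets (Suc K)" using assms(2) by (auto simp: card_gt_0_iff)
  then have "card (A - B) > 0" using card_removable[OF A] assms(1) by simp
  then obtain v where "v \<in> A - B" by (auto simp: card_gt_0_iff)
  with A have "A - {v} \<in> free_sets K" by (rule remove_in_free_sets)
  then show ?thesis using finite_free_sets by (auto simp: card_gt_0_iff)
qed

definition density :: "nat \<Rightarrow> real" where
  "density K = real (card (free_sets K)) / real (card V choose K)"

definition mean_blockers :: "nat \<Rightarrow> real" where
  "mean_blockers K = real (blocked_pairs K) / real (card (free_sets K))"

lemma density_Suc:
  assumes K: "card B \<le> K" "K < card V"
  shows "density (Suc K) * (1 - real (card B) / real (Suc K))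
    = density K * (1 - mean_blockers K / (real (card V) - real K))"
proof (cases "card (free_sets K) = 0")
  case True
  then have "card (free_sets (Suc K)) = 0" using card_free_sets_pos[OF K(1)] by auto
  then show ?thesis using True by (simp add: density_def)
next
  case False
  define N where "N = real (card V) - real K"
  define c where "c = real (card V choose K)"
  define c' where "c' = real (card V choose Suc K)"
  have pos: "0 < N" "0 < c" "0 < c'" using K by (simp_all add: N_def c_def c'_def)
  have "real (Suc K) * c' = real (card V - K) * c"
    unfolding c_def c'_def of_nat_mult[symmetric] Suc_times_binomial_Suc ..
  then have binomial: "real (Suc K) * c' = N * c" using K by (simp add: N_def of_nat_diff)
  have "real (blocked_pairs K + (Suc K - card B) * card (free_sets (Suc K)))
      = real ((card V - K) * card (free_sets K))"
    by (simp only: blocked_pairs_add_removals)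
  then have removals: "(real (Suc K) - real (card B)) * real (card (free_sets (Suc K)))
      = N * real (card (free_sets K)) - real (blocked_pairs K)"
    using K by (simp add: N_def of_nat_diff)
  have "density (Suc K) * (1 - real (card B) / real (Suc K))
      = (real (Suc K) - real (card B)) * real (card (free_sets (Suc K))) / (real (Suc K) * c')"
    using pos by (simp add: density_def c'_def[symmetric] field_simps)
  also have "\<dots> = (N * real (card (free_sets K)) - real (blocked_pairs K)) / (N * c)"
    unfolding removals binomial ..
  also have "\<dots> = density K * (1 - mean_blockers K / N)"
    using pos False by (simp add: density_def mean_blockers_def c_def[symmetric] field_simps)
  finally show ?thesis by (simp only: N_def)
qed

lemma mean_blockers_Suc:
  assumes K: "card B \<le> K"
  shows "mean_blockers (Suc K) * (1 - (real r - 1) / (real (Suc K) - real (card B)))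
    \<le> mean_blockers K"
proof (cases "card (free_sets (Suc K)) = 0")
  case True
  then show ?thesis by (simp add: mean_blockers_def)
next
  case False
  define M where "M = real (Suc K) - real (card B)"
  have pos: "0 < M" "0 < card (free_sets K)" "0 < card (free_sets (Suc K))"
    using K False card_free_sets_pos[OF K] by (simp_all add: M_def)
  have "(M - (real r - 1)) * real (blocked_pairs (Suc K)) * real (card (free_sets K))
      \<le> real (Suc K - card B - (r - 1)) * real (blocked_pairs (Suc K)) * real (card (free_sets K))"
    using rank_pos by (intro mult_right_mono) (auto simp: M_def)
  also have "\<dots> \<le> real (Suc K - card B) * real (card (free_sets (Suc K))) * real (blocked_pairs K)"
    using moon_moser[of K] by (simp only: of_nat_mult[symmetric] of_nat_le_iff)
  also have "real (Suc K - card B) = M" using K by (simp add: M_def of_nat_diff)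
  finally have "mean_blockers (Suc K) * (1 - (real r - 1) / M) \<le> mean_blockers K"
    using pos by (simp add: mean_blockers_def field_simps)
  then show ?thesis by (simp only: M_def)
qed

sublocale extension_profile density mean_blockers "card B" "card V" r
proof unfold_locales
  show "0 \<le> density K" "0 \<le> mean_blockers K" for K
    by (simp_all add: density_def mean_blockers_def)
qed (fact density_Suc mean_blockers_Suc rank_pos)+

end

section \<open>Sets with a prescribed number of edges\<close>

abbreviation edges_in :: "'a set set \<Rightarrow> 'a set \<Rightarrow> 'a set set" where
  "edges_in E S \<equiv> {e \<in> E. e \<subseteq> S}"

definition rich_sets :: "'a set \<Rightarrow> 'a set set \<Rightarrow> nat \<Rightarrow> nat \<Rightarrow> 'a set set" where
  "rich_sets V E K l = {S. S \<subseteq> V \<and> card S = K \<and> l \<le> card (edges_in E S)}"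

definition edge_class :: "'a set \<Rightarrow> 'a set set \<Rightarrow> 'a set set \<Rightarrow> nat \<Rightarrow> 'a set set" where
  "edge_class V E L K = {A. A \<subseteq> V \<and> card A = K \<and> edges_in E A = L}"

definition edge_class_density :: "'a set \<Rightarrow> 'a set set \<Rightarrow> 'a set set \<Rightarrow> nat \<Rightarrow> real" where
  "edge_class_density V E L K = real (card (edge_class V E L K)) / real (card V choose K)"

lemma finite_rich_sets: "finite V \<Longrightarrow> finite (rich_sets V E K l)"
  by (rule finite_subset[of _ "Pow V"]) (auto simp: rich_sets_def)

lemma hypergraph_finite:
  assumes "hypergraph V E"
  shows "finite V" "finite E" "e \<in> E \<Longrightarrow> finite e"
proof -
  show "finite V" using assms by (simp add: hypergraph_def)
  moreover have "E \<subseteq> Pow V" using assms by (auto simp: hypergraph_def)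
  ultimately show "finite E" "e \<in> E \<Longrightarrow> finite e" by (auto intro: finite_subset)
qed

lemma remove_covered_not_rich:
  assumes E: "finite E" and A: "A \<in> good_sets V E K l" and v: "v \<in> \<Union>(edges_in E A)"
  shows "A - {v} \<notin> rich_sets V E K' l"
proof -
  have "edges_in E (A - {v}) \<subset> edges_in E A" using v by blast
  then have "card (edges_in E (A - {v})) < card (edges_in E A)"
    using E by (intro psubset_card_mono) auto
  then show ?thesis using A by (simp add: rich_sets_def good_sets_def)
qed

lemma rich_sets_double_count:
  assumes V: "finite V" and E: "finite E"
  shows "(card V - K) * card (rich_sets V E K l)
    = (\<Sum>A\<in>rich_sets V E (Suc K) l. card {v \<in> A. A - {v} \<in> rich_sets V E K l})"
proof -
  have fin: "finite A" if "A \<in> rich_sets V E j l" for A j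
    using that V finite_subset by (auto simp: rich_sets_def)
  have "(card V - K) * card (rich_sets V E K l) = (\<Sum>A\<in>rich_sets V E K l. card (V - A))"
    using V finite_subset[OF _ V] by (simp add: rich_sets_def card_Diff_subset)
  also have "\<dots> = (\<Sum>A\<in>rich_sets V E (Suc K) l. card {v \<in> A. A - {v} \<in> rich_sets V E K l})"
    unfolding card_eq_sum
  proof (rule sum_insert_eq_sum_remove)
    fix A v assume A: "A \<in> rich_sets V E K l" and v: "v \<in> V - A"
    have "card (edges_in E A) \<le> card (edges_in E (insert v A))"
      using E by (intro card_mono) auto
    then show "v \<notin> A \<and> insert v A \<in> rich_sets V E (Suc K) l
        \<and> v \<in> {u \<in> insert v A. insert v A - {u} \<in> rich_sets V E K l}"
      using A v fin[OF A] by (auto simp: rich_sets_def)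
  next
    fix A v assume "A \<in> rich_sets V E (Suc K) l" "v \<in> {v \<in> A. A - {v} \<in> rich_sets V E K l}"
    then show "v \<in> A \<and> A - {v} \<in> rich_sets V E K l \<and> v \<in> V - (A - {v})"
      by (auto simp: rich_sets_def)
  qed (use V fin in \<open>auto simp: finite_rich_sets\<close>)
  finally show ?thesis .
qed

lemma sum_card_covered_le:
  assumes V: "finite V" and E: "finite E"
  shows "(\<Sum>A\<in>good_sets V E K l. card (\<Union>(edges_in E A)))
    \<le> (\<Sum>A\<in>rich_sets V E K l. card {v \<in> A. A - {v} \<notin> rich_sets V E K' l})"
proof -
  have "(\<Sum>A\<in>good_sets V E K l. card (\<Union>(edges_in E A)))
      \<le> (\<Sum>A\<in>good_sets V E K l. card {v \<in> A. A - {v} \<notin> rich_sets V E K' l})"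
  proof (intro sum_mono card_mono)
    fix A assume A: "A \<in> good_sets V E K l"
    then have "finite A" using V finite_subset by (auto simp: good_sets_def)
    then show "finite {v \<in> A. A - {v} \<notin> rich_sets V E K' l}" by simp
    show "\<Union>(edges_in E A) \<subseteq> {v \<in> A. A - {v} \<notin> rich_sets V E K' l}"
      using remove_covered_not_rich[OF E A] by blast
  qed
  also have "\<dots> \<le> (\<Sum>A\<in>rich_sets V E K l. card {v \<in> A. A - {v} \<notin> rich_sets V E K' l})"
    using V by (intro sum_mono2) (auto simp: finite_rich_sets rich_sets_def good_sets_def)
  finally show ?thesis .
qed

lemma rich_sets_Suc_ge:
  assumes V: "finite V" and E: "finite E"
  shows "(card V - K) * card (rich_sets V E K l)
      + (\<Sum>A\<in>good_sets V E (Suc K) l. card (\<Union>(edges_in E A)))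
    \<le> Suc K * card (rich_sets V E (Suc K) l)"
proof -
  let ?kept = "\<lambda>A. {v \<in> A. A - {v} \<in> rich_sets V E K l}"
  let ?lost = "\<lambda>A. {v \<in> A. A - {v} \<notin> rich_sets V E K l}"
  have "(card V - K) * card (rich_sets V E K l)
      + (\<Sum>A\<in>good_sets V E (Suc K) l. card (\<Union>(edges_in E A)))
    \<le> (\<Sum>A\<in>rich_sets V E (Suc K) l. card (?kept A) + card (?lost A))"
    using rich_sets_double_count[OF V E, of K l] sum_card_covered_le[OF V E, of "Suc K" l K]
    by (simp add: sum.distrib)
  also have "\<dots> = (\<Sum>A\<in>rich_sets V E (Suc K) l. Suc K)"
  proof (rule sum.cong[OF refl])
    fix A assume A: "A \<in> rich_sets V E (Suc K) l"
    then have "finite A" using V finite_subset by (auto simp: rich_sets_def)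
    then have "card (?kept A) + card (?lost A) = card (?kept A \<union> ?lost A)"
      by (intro card_Un_disjoint[symmetric]) auto
    also have "?kept A \<union> ?lost A = A" by auto
    finally show "card (?kept A) + card (?lost A) = Suc K" using A by (simp add: rich_sets_def)
  qed
  finally show ?thesis by (simp add: mult.commute)
qed

lemma sum_covered_le_rich_density_diff:
  assumes V: "finite V" and E: "finite E" and K: "K < card V"
  shows "(\<Sum>A\<in>good_sets V E (Suc K) l. real (card (\<Union>(edges_in E A))))
      / (real (Suc K) * real (card V choose Suc K))
    \<le> real (card (rich_sets V E (Suc K) l)) / real (card V choose Suc K)
      - real (card (rich_sets V E K l)) / real (card V choose K)"
proof -
  define N where "N = real (card V - K)"
  define c where "c = real (card V choose K)"
  define c' where "c' = real (card V choose Suc K)"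
  have pos: "0 < N" "0 < c" "0 < c'" using K by (simp_all add: N_def c_def c'_def)
  have binomial: "real (Suc K) * c' = N * c"
    unfolding N_def c_def c'_def of_nat_mult[symmetric] Suc_times_binomial_Suc ..
  let ?R = "\<lambda>K. real (card (rich_sets V E K l))"
  let ?S = "\<Sum>A\<in>good_sets V E (Suc K) l. real (card (\<Union>(edges_in E A)))"
  have "N * ?R K + ?S \<le> real (Suc K) * ?R (Suc K)"
    using rich_sets_Suc_ge[OF V E, of K l] unfolding N_def
    by (simp only: of_nat_mult[symmetric] of_nat_sum[symmetric] of_nat_add[symmetric] of_nat_le_iff)
  then have "?S / (real (Suc K) * c')
      \<le> (real (Suc K) * ?R (Suc K) - N * ?R K) / (real (Suc K) * c')"
    using pos by (intro divide_right_mono) auto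
  also have "\<dots> = ?R (Suc K) / c' - N * ?R K / (real (Suc K) * c')"
    using pos by (simp add: diff_divide_distrib del: of_nat_Suc)
  also have "N * ?R K / (real (Suc K) * c') = ?R K / c"
    using pos by (simp add: binomial del: of_nat_Suc)
  finally show ?thesis by (simp only: c_def c'_def)
qed

lemma sum_covered_le_1:
  assumes V: "finite V" and E: "finite E"
  shows "(\<Sum>K\<in>{1..card V}. (\<Sum>A\<in>good_sets V E K l. real (card (\<Union>(edges_in E A))))
      / (real K * real (card V choose K))) \<le> 1"
proof -
  let ?n = "card V"
  define rich_density
    where "rich_density K = real (card (rich_sets V E K l)) / real (?n choose K)" for K
  have "(\<Sum>K\<in>{1..?n}. (\<Sum>A\<in>good_sets V E K l. real (card (\<Union>(edges_in E A))))
      / (real K * real (?n choose K)))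
    = (\<Sum>K<?n. (\<Sum>A\<in>good_sets V E (Suc K) l. real (card (\<Union>(edges_in E A))))
      / (real (Suc K) * real (?n choose Suc K)))"
    unfolding One_nat_def by (rule sum.atLeast1_atMost_eq)
  also have "\<dots> \<le> (\<Sum>K<?n. rich_density (Suc K) - rich_density K)"
    unfolding rich_density_def
    using sum_covered_le_rich_density_diff[OF V E] by (intro sum_mono) auto
  also have "\<dots> = rich_density ?n - rich_density 0" by (rule sum_lessThan_telescope)
  also have "\<dots> \<le> rich_density ?n" by (simp add: rich_density_def)
  also have "\<dots> \<le> 1"
  proof -
    have "rich_sets V E ?n l \<subseteq> {V}"
      using card_subset_eq[OF V] unfolding rich_sets_def by blast
    then show ?thesis
      using card_mono[of "{V}" "rich_sets V E ?n l"] by (simp add: rich_density_def)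
  qed
  finally show ?thesis .
qed

lemma sum_good_sets_by_edges:
  fixes h :: "'a set set \<Rightarrow> real"
  assumes V: "finite V" and E: "finite E"
  shows "(\<Sum>A\<in>good_sets V E K l. h (edges_in E A))
    = (\<Sum>L | L \<subseteq> E \<and> card L = l. h L * real (card (edge_class V E L K)))"
proof -
  have "(\<Sum>A\<in>good_sets V E K l. h (edges_in E A))
      = (\<Sum>L | L \<subseteq> E \<and> card L = l. \<Sum>A | A \<in> good_sets V E K l \<and> edges_in E A = L. h (edges_in E A))"
    using finite_good_sets[OF V] E by (intro sum.group[symmetric]) (auto simp: good_sets_def)
  also have "\<dots> = (\<Sum>L | L \<subseteq> E \<and> card L = l. h L * real (card (edge_class V E L K)))"
  proof (rule sum.cong[OF refl])
    fix L assume "L \<in> {L. L \<subseteq> E \<and> card L = l}"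
    then have "{A \<in> good_sets V E K l. edges_in E A = L} = edge_class V E L K"
      by (auto simp: good_sets_def edge_class_def)
    then show "(\<Sum>A | A \<in> good_sets V E K l \<and> edges_in E A = L. h (edges_in E A))
        = h L * real (card (edge_class V E L K))"
      by (simp add: edge_class_def)
  qed
  finally show ?thesis .
qed

lemma edge_prob_eq_sum_edge_class_density:
  assumes V: "finite V" and E: "finite E" and "k \<le> card V"
  shows "edge_prob V E k l = (\<Sum>L | L \<subseteq> E \<and> card L = l. edge_class_density V E L k)"
  using edge_prob_eq[OF V, of k E l] assms(3) sum_good_sets_by_edges[OF V E, of "\<lambda>_. 1" k l]
  by (simp add: edge_class_density_def sum_divide_distrib)

lemma sum_cover_edge_class_density_le_1:
  assumes V: "finite V" and E: "finite E"
  shows "(\<Sum>L | L \<subseteq> E \<and> card L = l. \<Sum>K\<in>{1..card V}.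
      real (card (\<Union>L)) / real K * edge_class_density V E L K) \<le> 1"
proof -
  have "(\<Sum>L | L \<subseteq> E \<and> card L = l. \<Sum>K\<in>{1..card V}.
      real (card (\<Union>L)) / real K * edge_class_density V E L K)
    = (\<Sum>K\<in>{1..card V}. (\<Sum>A\<in>good_sets V E K l. real (card (\<Union>(edges_in E A))))
      / (real K * real (card V choose K)))"
    unfolding sum_good_sets_by_edges[OF V E, of "\<lambda>L. real (card (\<Union>L))"] sum_divide_distrib
      edge_class_density_def by (subst sum.swap) simp
  also have "\<dots> \<le> 1" by (rule sum_covered_le_1[OF V E])
  finally show ?thesis .
qed

lemma edges_in_eq_iff:
  assumes "L \<subseteq> E"
  shows "edges_in E A = L \<longleftrightarrow> \<Union>L \<subseteq> A \<and> (\<forall>e\<in>E - L. \<not> e \<subseteq> A)"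
  using assms by blast

lemma edge_class_density_le_sum:
  assumes H: "hypergraph V E" "\<forall>e\<in>E. card e \<le> r" "1 \<le> r" and L: "L \<subseteq> E"
    and m: "8 * r \<le> card (\<Union>L)" "card (\<Union>L) < k" and n: "3 * k \<le> card V"
  shows "edge_class_density V E L k * window_weight r k (card (\<Union>L))
    \<le> (\<Sum>K\<in>{1..card V}. real (card (\<Union>L)) / real K * edge_class_density V E L K)"
proof -
  interpret forbidden_subsets V "\<Union>L" "E - L" r
    using H L hypergraph_finite[OF H(1)] by unfold_locales (auto simp: hypergraph_def)
  have "edge_class V E L K = free_sets K" for K
    using edges_in_eq_iff[OF L] by (auto simp: edge_class_def free_sets_def free_def)
  then have "edge_class_density V E L K = density K" for K
    by (simp add: edge_class_density_def density_def)
  with window_weight_mult_le_sum[OF m n] show ?thesis by simp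
qed

lemma edge_prob_mult_le_1:
  assumes H: "hypergraph V E" "\<forall>e\<in>E. card e \<le> r" "1 \<le> r" and n: "3 * k \<le> card V"
    and L: "\<And>L. L \<subseteq> E \<Longrightarrow> card L = l \<Longrightarrow>
      8 * r \<le> card (\<Union>L) \<and> card (\<Union>L) < k \<and> c \<le> window_weight r k (card (\<Union>L))"
  shows "edge_prob V E k l * c \<le> 1"
proof -
  note fin = hypergraph_finite(1,2)[OF H(1)]
  have "edge_prob V E k l * c = (\<Sum>L | L \<subseteq> E \<and> card L = l. edge_class_density V E L k * c)"
    using edge_prob_eq_sum_edge_class_density[OF fin, of k l] n by (simp add: sum_distrib_right)
  also have "\<dots> \<le> (\<Sum>L | L \<subseteq> E \<and> card L = l. \<Sum>K\<in>{1..card V}.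
      real (card (\<Union>L)) / real K * edge_class_density V E L K)"
  proof (rule sum_mono)
    fix L assume "L \<in> {L. L \<subseteq> E \<and> card L = l}"
    then have "L \<subseteq> E" and m: "8 * r \<le> card (\<Union>L)" "card (\<Union>L) < k"
      and c: "c \<le> window_weight r k (card (\<Union>L))" using L by auto
    have "edge_class_density V E L k * c
        \<le> edge_class_density V E L k * window_weight r k (card (\<Union>L))"
      using c by (intro mult_left_mono) (auto simp: edge_class_density_def)
    also have "\<dots> \<le> (\<Sum>K\<in>{1..card V}. real (card (\<Union>L)) / real K * edge_class_density V E L K)"
      by (rule edge_class_density_le_sum[OF H \<open>L \<subseteq> E\<close> m n])
    finally show "edge_class_density V E L k * c
        \<le> (\<Sum>K\<in>{1..card V}. real (card (\<Union>L)) / real K * edge_class_density V E L K)" .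
  qed
  also have "\<dots> \<le> 1" by (rule sum_cover_edge_class_density_le_1[OF fin])
  finally show ?thesis .
qed

section \<open>The number of vertices covered by \<open>l\<close> edges\<close>

lemma sum_binomial_le_power:
  assumes "1 \<le> r" "r \<le> m"
  shows "real (\<Sum>i\<le>r. m choose i) \<le> (3 * real m / real r) ^ r"
proof -
  let ?x = "real r / real m"
  have x: "0 < ?x" "?x \<le> 1" using assms by auto
  have "real (\<Sum>i\<le>r. m choose i) * ?x ^ r \<le> (\<Sum>i\<le>r. real (m choose i) * ?x ^ i)"
    unfolding of_nat_sum sum_distrib_right
    by (intro sum_mono mult_left_mono power_decreasing) (use x in auto)
  also have "\<dots> \<le> (\<Sum>i\<le>m. real (m choose i) * ?x ^ i)"
    by (rule sum_mono2) (use assms in auto)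
  also have "\<dots> = (?x + 1) ^ m" by (simp add: binomial_ring)
  also have "\<dots> \<le> exp ?x ^ m"
    using exp_ge_add_one_self[of ?x] by (intro power_mono) (auto simp: add.commute)
  also have "\<dots> = exp (real r)" using assms by (simp add: exp_of_nat_mult[symmetric])
  also have "\<dots> = exp 1 ^ r" by (simp add: exp_of_nat_mult[symmetric])
  also have "\<dots> \<le> 3 ^ r" by (intro power_mono exp_le) simp
  finally have "real (\<Sum>i\<le>r. m choose i) \<le> 3 ^ r / ?x ^ r"
    using x by (simp add: pos_le_divide_eq)
  also have "\<dots> = (3 * real m / real r) ^ r" by (simp add: power_divide power_mult_distrib)
  finally show ?thesis .
qed

lemma card_le_sum_binomial_Union:
  assumes "finite L" and L: "\<And>e. e \<in> L \<Longrightarrow> finite e \<and> card e \<le> r"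
  shows "card L \<le> (\<Sum>i\<le>r. card (\<Union>L) choose i)"
proof -
  have U: "finite (\<Union>L)" using assms by auto
  have "L \<subseteq> (\<Union>i\<le>r. {e. e \<subseteq> \<Union>L \<and> card e = i})" using L by auto
  then have "card L \<le> card (\<Union>i\<le>r. {e. e \<subseteq> \<Union>L \<and> card e = i})"
    using U by (intro card_mono) auto
  also have "\<dots> \<le> (\<Sum>i\<le>r. card {e. e \<subseteq> \<Union>L \<and> card e = i})" by (rule card_UN_le) simp
  also have "\<dots> = (\<Sum>i\<le>r. card (\<Union>L) choose i)" by (simp add: n_subsets[OF U])
  finally show ?thesis .
qed

lemma card_le_power_card_Union:
  assumes "finite L" and L: "\<And>e. e \<in> L \<Longrightarrow> finite e \<and> card e \<le> r" and "1 \<le> r" "2 ^ r \<le> card L"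
  shows "real (card L) \<le> (3 * real (card (\<Union>L)) / real r) ^ r"
proof -
  have U: "finite (\<Union>L)" using assms by auto
  have "card L \<le> card (Pow (\<Union>L))" using U by (intro card_mono) auto
  with assms(4) have "2 ^ r \<le> card (Pow (\<Union>L))" by (rule order_trans)
  then have "(2::nat) ^ r \<le> 2 ^ card (\<Union>L)" by (simp only: card_Pow[OF U])
  then have "r \<le> card (\<Union>L)" by simp
  with assms(3) have "real (\<Sum>i\<le>r. card (\<Union>L) choose i) \<le> (3 * real (card (\<Union>L)) / real r) ^ r"
    by (rule sum_binomial_le_power)
  then show ?thesis
    using of_nat_mono[OF card_le_sum_binomial_Union[OF assms(1) L], where ?'a = real] by linarith
qed

lemma power2_le_card_Union:
  fixes x :: real
  assumes "finite L" and L: "\<And>e. e \<in> L \<Longrightarrow> finite e \<and> card e \<le> r" and "1 \<le> r"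
    and x: "2 \<le> x" "x ^ (2 * r) = real (card L)"
  shows "x\<^sup>2 \<le> 3 * real (card (\<Union>L)) / real r"
proof -
  have "2 ^ r \<le> x ^ r" using x(1) by (intro power_mono) auto
  also have "\<dots> \<le> x ^ (2 * r)" using x(1) by (intro power_increasing) auto
  finally have "real (2 ^ r) \<le> real (card L)" by (simp add: x(2))
  then have "2 ^ r \<le> card L" by (simp only: of_nat_le_iff)
  then have "(x\<^sup>2) ^ r \<le> (3 * real (card (\<Union>L)) / real r) ^ r"
    using card_le_power_card_Union[OF assms(1) L] assms(3) x(2) by (simp add: power_mult)
  then show ?thesis using assms(3) by (subst (asm) power_mono_iff) auto
qed

lemma card_Union_le_mult:
  assumes "\<And>e. e \<in> L \<Longrightarrow> card e \<le> r"
  shows "card (\<Union>L) \<le> r * card L"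
proof -
  have "card (\<Union>L) \<le> (\<Sum>e\<in>L. card e)" by (rule card_Union_le_sum_card)
  also have "\<dots> \<le> (\<Sum>e\<in>L. r)" using assms by (intro sum_mono)
  finally show ?thesis by (simp add: mult.commute)
qed

section \<open>The bound\<close>

lemma window_weight_ge_small_cover:
  fixes x m k r :: real
  assumes "0 \<le> x" "x\<^sup>2 \<le> 3 * m / r" "0 < r" "0 < k" "m \<le> k / 2"
  shows "x / 100 \<le> window_weight r k m"
proof -
  have "(x / 5)\<^sup>2 \<le> m / (8 * r)"
  proof -
    have "0 \<le> 3 * m / r" using assms(2) by (meson order_trans zero_le_power2)
    then show ?thesis using assms(2) by (simp add: power_divide)
  qed
  then have root: "x / 5 \<le> sqrt (m / (8 * r))" by (rule real_le_rsqrt)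
  have "1 / 8 \<le> (k - m) / (4 * k)" using assms(4,5) by (simp add: field_simps)
  then have "1 / 8 * (x / 5) \<le> window_weight r k m"
    unfolding window_weight_def using root assms by (intro mult_mono) auto
  with assms(1) show ?thesis by simp
qed

lemma window_weight_ge_large_cover:
  fixes x m k r \<epsilon> :: real
  assumes "0 \<le> x" "x ^ 4 \<le> k" "0 < r" "0 < k" "0 < \<epsilon>"
    and m: "k / 2 \<le> m" "m \<le> (1 - \<epsilon>) * k" and k: "r\<^sup>2 / \<epsilon> ^ 4 \<le> k"
  shows "x / 100 \<le> window_weight r k m"
proof -
  have "(x\<^sup>2 * r)\<^sup>2 = x ^ 4 * r\<^sup>2" by (simp add: power_mult_distrib)
  also have "\<dots> \<le> k * (k * \<epsilon> ^ 4)"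
    using assms by (intro mult_mono) (auto simp: divide_le_eq)
  also have "\<dots> = (\<epsilon>\<^sup>2 * k)\<^sup>2" by (simp add: power2_eq_square power4_eq_xxxx mult_ac)
  finally have "x\<^sup>2 * r \<le> \<epsilon>\<^sup>2 * k" by (rule power2_le_imp_le) (use assms(4) in simp)
  then have "(x / (4 * \<epsilon>))\<^sup>2 \<le> k / (16 * r)"
    using assms(3,5)
    by (simp add: power_divide power_mult_distrib pos_divide_le_eq pos_le_divide_eq mult_ac)
  also have "\<dots> \<le> m / (8 * r)" using assms(3) m(1) by (simp add: field_simps)
  finally have root: "x / (4 * \<epsilon>) \<le> sqrt (m / (8 * r))" by (rule real_le_rsqrt)
  have quotient: "\<epsilon> / 4 \<le> (k - m) / (4 * k)" using assms(4) m by (simp add: field_simps)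
  moreover have "0 \<le> (k - m) / (4 * k)" using quotient assms(5) by linarith
  ultimately have "\<epsilon> / 4 * (x / (4 * \<epsilon>)) \<le> window_weight r k m"
    unfolding window_weight_def using root assms(1,5) by (intro mult_mono) auto
  with assms show ?thesis by simp
qed

lemma window_weight_ge:
  fixes x m k r \<epsilon> :: real
  assumes "0 \<le> x" "x\<^sup>2 \<le> 3 * m / r" "x ^ 4 \<le> k" "0 < r" "0 < k" "0 < \<epsilon>"
    and "m \<le> (1 - \<epsilon>) * k" "r\<^sup>2 / \<epsilon> ^ 4 \<le> k"
  shows "x / 100 \<le> window_weight r k m"
proof (cases "m \<le> k / 2")
  case True
  then show ?thesis using assms by (intro window_weight_ge_small_cover)
next
  case False
  then show ?thesis using assms by (intro window_weight_ge_large_cover[where \<epsilon> = \<epsilon>]) auto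
qed

lemma edge_prob_le_if_large_root:
  fixes x \<epsilon> :: real
  assumes H: "hypergraph V E" "\<forall>e\<in>E. card e \<le> r" and r: "2 \<le> r" and \<epsilon>: "0 < \<epsilon>"
    and k: "(real r)\<^sup>2 / \<epsilon> ^ 4 \<le> real k" and n: "3 * k \<le> card V"
    and l: "real l \<le> (1 - \<epsilon>) * real k / real r"
    and x: "100 \<le> x" "x ^ (2 * r) = real l"
  shows "edge_prob V E k l * (x / 100) \<le> 1"
proof (rule edge_prob_mult_le_1[OF H _ n])
  fix L assume L: "L \<subseteq> E" "card L = l"
  let ?m = "card (\<Union>L)"
  have edges: "finite e \<and> card e \<le> r" if "e \<in> L" for e
    using that L(1) H hypergraph_finite(3)[OF H(1)] by auto
  have "finite L" using L(1) hypergraph_finite(2)[OF H(1)] by (rule finite_subset)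
  have "0 < (real r)\<^sup>2 / \<epsilon> ^ 4" using r \<epsilon> by simp
  then have k_pos: "0 < real k" using k by linarith
  have rl: "real (r * l) \<le> (1 - \<epsilon>) * real k" using l r by (simp add: field_simps)
  have "?m \<le> r * l" using card_Union_le_mult[of L r] edges L(2) by simp
  then have upper: "real ?m \<le> (1 - \<epsilon>) * real k" using rl of_nat_mono order_trans by blast
  have "(1 - \<epsilon>) * real k < 1 * real k" using \<epsilon> k_pos by (intro mult_strict_right_mono) auto
  with upper have "?m < k" by simp
  have lower: "x\<^sup>2 \<le> 3 * real ?m / real r"
    using \<open>finite L\<close> edges r x L(2) by (intro power2_le_card_Union) auto
  have "100\<^sup>2 \<le> x\<^sup>2" using x(1) by (intro power_mono) auto
  then have "100\<^sup>2 \<le> 3 * real ?m / real r" using lower by linarith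
  then have "8 * r \<le> ?m" using r by (simp add: field_simps)
  have "x ^ 4 \<le> x ^ (2 * r)" using x(1) r by (intro power_increasing) auto
  also have "\<dots> \<le> real (r * l)" unfolding x(2) using r by (intro of_nat_mono) simp
  also note rl
  also have "(1 - \<epsilon>) * real k \<le> real k" using \<epsilon> by (simp add: algebra_simps)
  finally have "x / 100 \<le> window_weight r k ?m"
    using lower upper x(1) r k_pos \<epsilon> k by (intro window_weight_ge[where \<epsilon> = \<epsilon>]) auto
  with \<open>8 * r \<le> ?m\<close> \<open>?m < k\<close>
  show "8 * r \<le> ?m \<and> ?m < k \<and> x / 100 \<le> window_weight r k ?m" by simp
qed (use r in auto)

lemma edge_prob_le_power:
  fixes \<epsilon> :: real
  assumes H: "hypergraph V E" "\<forall>e\<in>E. card e \<le> r" and r: "2 \<le> r" and \<epsilon>: "0 < \<epsilon>"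
    and k: "(real r)\<^sup>2 / \<epsilon> ^ 4 \<le> real k" and n: "3 * k \<le> card V"
    and l: "1 \<le> l" "real l \<le> (1 - \<epsilon>) * real k / real r"
  shows "edge_prob V E k l \<le> 100 * real l powr (- 1 / (2 * real r))"
proof -
  define x where "x = real l powr (1 / (2 * real r))"
  have x: "0 < x" "x ^ (2 * r) = real l" "real l powr (- 1 / (2 * real r)) = 1 / x"
    using r l(1) by (simp_all add: x_def powr_power powr_minus_divide)
  have "edge_prob V E k l * (x / 100) \<le> 1"
  proof (cases "x \<le> 100")
    case True
    then have "edge_prob V E k l * (x / 100) \<le> 1 * 1"
      unfolding edge_prob_def using x(1) by (intro mult_mono) auto
    then show ?thesis by simp
  next
    case False
    then show ?thesis using x(2) by (intro edge_prob_le_if_large_root[OF H r \<epsilon> k n l(2)]) auto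
  qed
  then show ?thesis unfolding x(3) using x(1) by (simp add: field_simps)
qed

lemma I_unif_eq: "I_unif r n k l = Max (edge_probs (\<lambda>e. card e = r) n k l)"
  and I_atmost_eq: "I_atmost r n k l = Max (edge_probs (\<lambda>e. card e \<le> r) n k l)"
  by (simp_all add: I_unif_def I_atmost_def edge_probs_def)

lemma LIMSEQ_I_unif: "(\<lambda>n. I_unif r n k l) \<longlonglongrightarrow> ind_unif r k l"
  and LIMSEQ_I_atmost: "(\<lambda>n. I_atmost r n k l) \<longlonglongrightarrow> ind_atmost r k l"
  unfolding ind_unif_def ind_atmost_def
  using convergent_I_unif convergent_I_atmost by (simp_all add: convergent_LIMSEQ_iff)

lemma edge_probs_mono:
  assumes "\<And>e. P e \<Longrightarrow> Q e"
  shows "edge_probs P n k l \<subseteq> edge_probs Q n k l"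
  unfolding edge_probs_def using assms by blast

lemma ind_unif_le_ind_atmost: "ind_unif r k l \<le> ind_atmost r k l"
proof (rule LIMSEQ_le[OF LIMSEQ_I_unif LIMSEQ_I_atmost], intro exI allI impI)
  fix n assume "k \<le> n"
  then show "I_unif r n k l \<le> I_atmost r n k l"
    unfolding I_unif_eq I_atmost_eq
    by (intro Max_mono edge_probs_mono edge_probs_nonempty finite_edge_probs) simp
qed

lemma ind_atmost_leI:
  assumes "k \<le> N"
    and bound: "\<And>(V :: nat set) E. hypergraph V E \<Longrightarrow> \<forall>e\<in>E. card e \<le> r \<Longrightarrow> N \<le> card V \<Longrightarrow>
      edge_prob V E k l \<le> c"
  shows "ind_atmost r k l \<le> c"
proof (rule LIMSEQ_le_const2[OF LIMSEQ_I_atmost], intro exI allI impI)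
  fix n assume "N \<le> n"
  moreover from this have "p \<le> c" if "p \<in> edge_probs (\<lambda>e. card e \<le> r) n k l" for p
    using that bound by (auto simp: edge_probs_def)
  ultimately show "I_atmost r n k l \<le> c"
    unfolding I_atmost_eq using assms(1)
    by (intro Max.boundedI edge_probs_nonempty finite_edge_probs) auto
qed

theorem theorem1p5:
  fixes r :: nat and \<epsilon> :: real
  assumes "r \<ge> 3" and "\<epsilon> > 0"
  shows "\<exists>k0::nat. \<forall>k\<ge>k0. \<forall>l::nat.
           1 \<le> l \<and> real l \<le> (1 - \<epsilon>) * real k / real r \<longrightarrow>
             ind_unif r k l \<le> ind_atmost r k l \<and>
             ind_atmost r k l \<le> 100 * real l powr (- 1 / (2 * real r))"
proof (intro exI allI impI conjI)
  fix k l :: nat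
  show "ind_unif r k l \<le> ind_atmost r k l" by (rule ind_unif_le_ind_atmost)
  assume "nat \<lceil>(real r)\<^sup>2 / \<epsilon> ^ 4\<rceil> \<le> k" and l: "1 \<le> l \<and> real l \<le> (1 - \<epsilon>) * real k / real r"
  then have k: "(real r)\<^sup>2 / \<epsilon> ^ 4 \<le> real k" by linarith
  show "ind_atmost r k l \<le> 100 * real l powr (- 1 / (2 * real r))"
  proof (rule ind_atmost_leI[of k "3 * k"])
    fix V :: "nat set" and E
    assume "hypergraph V E" "\<forall>e\<in>E. card e \<le> r" "3 * k \<le> card V"
    then show "edge_prob V E k l \<le> 100 * real l powr (- 1 / (2 * real r))"
      using edge_prob_le_power[of V E r \<epsilon> k l] assms k l by simp
  qed simp
qed

end
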